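(* Let $M$ be a set and let $\vdash$ be a relation between nonempty finite sequences $a_1,\dots,a_n$ of elements of $M$ and elements $b\in M$ satisfying, for all $a,b,c,a_1,\dots,a_n\in M$: 1. $a\vdash a$; 2. $a_1,\dots,a_n\vdash b$ implies $a_1,\dots,a_n,c\vdash b$; 3. $a_1,\dots,a_n\vdash b$ implies $a_1,\dots,a_{i+1},a_i,\dots,a_n\vdash b$; 4. $a_1,\dots,a_n\vdash c$ and $a_1,\dots,a_n,c\vdash b$ imply $a_1,\dots,a_n\vdash b$. Regard $M$ as preordered by $a\le b :\Leftrightarrow a\vdash b$. Then there exists a minimal semilattice $H$ over $M$ such that for all $a_1,\dots,a_n,b\in M$, \[ a_1,\dots,a_n\vdash b \iff a_1\wedge\dots\wedge a_n\le b \text{ in } H, \] and any two minimal semilattices over $M$ with this property are isomorphic over $M$.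
   Context: A preordered set is a set with a reflexive transitive relation $\le$; $a\equiv b$ means $a\le b$ and $b\le a$. A semilattice is a preordered set in which any $a,b$ have a greatest lower bound $c$ (i.e. $c\le a$, $c\le b$, and $x\le a,x\le b\Rightarrow x\le c$), unique up to $\equiv$ and denoted $a\wedge b$. $M$ (preordered) is a part of a preordered set $H$ if $M\subseteq H$ and the preorder of $M$ is the restriction of that of $H$; $H$ is then a semilattice over $M$ if it is a semilattice. A semilattice $H$ over $M$ is minimal if there is no proper subset $H_0\subsetneq H$ with $M\subseteq H_0$ and such that $a,b\in H_0$, $c\equiv a\wedge b$ imply $c\in H_0$. For preordered sets $A,A'$, a homomorphism from $A$ into $A'$ is a relation $\sim$ between $A$ and $A'$ such that: every $a\in A$ has some $a'$ with $a\sim a'$; $a\sim a_1'$ and $a_1'\equiv a_2'$ imply $a\sim a_2'$; $a\sim a'$, $b\sim b'$, $a\le b$ imply $a'\le b'$. It is an isomorphism if moreover $a\sim a'$, $b\sim b'$, $a'\le b'$ imply $a\le b$; it is onto $A'$ if every $a'\in A'$ has some $a$ with $a\sim a'$. If $M_0$ is a part of both $A$ and $A'$, $A'$ is isomorphic to $A$ over $M_0$ if there is an isomorphism $\sim$ from $A$ onto $A'$ with $a_0\sim a_0$ for all $a_0\in M_0$. *)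

theory Defs
  imports Main
begin

definition equiv_in :: "'a rel \<Rightarrow> 'a \<Rightarrow> 'a \<Rightarrow> bool" where
  "equiv_in r a b \<longleftrightarrow> (a, b) \<in> r \<and> (b, a) \<in> r"

definition is_meet :: "'a set \<Rightarrow> 'a rel \<Rightarrow> 'a \<Rightarrow> 'a \<Rightarrow> 'a \<Rightarrow> bool" where
  "is_meet H r a b c \<longleftrightarrow>
     c \<in> H \<and> (c, a) \<in> r \<and> (c, b) \<in> r \<and> (\<forall>x\<in>H. (x, a) \<in> r \<and> (x, b) \<in> r \<longrightarrow> (x, c) \<in> r)"

definition semilattice_on :: "'a set \<Rightarrow> 'a rel \<Rightarrow> bool" where
  "semilattice_on H r \<longleftrightarrow> preorder_on H r \<and> (\<forall>a\<in>H. \<forall>b\<in>H. \<exists>c. is_meet H r a b c)"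

text \<open>Meets are unique only up to \<^const>\<open>equiv_in\<close>; \<open>meet\<close> picks one of them.\<close>

definition meet :: "'a set \<Rightarrow> 'a rel \<Rightarrow> 'a \<Rightarrow> 'a \<Rightarrow> 'a" where
  "meet H r a b = (SOME c. is_meet H r a b c)"

text \<open>The iterated meet of a nonempty sequence, bracketed to the left.\<close>

definition meet_list :: "'a set \<Rightarrow> 'a rel \<Rightarrow> 'a list \<Rightarrow> 'a" where
  "meet_list H r as = foldl (meet H r) (hd as) (tl as)"

text \<open>
  A superset of \<open>M\<close> may need more elements than the type of \<open>M\<close> has, so the inclusion of \<open>M\<close>
  in \<open>H\<close> is an injection \<open>e\<close> into a possibly different type; \<open>e = id\<close> is the literal inclusion
  \<open>M \<subseteq> H\<close> with \<open>r = Restr s M\<close>.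
\<close>

definition part_of :: "('a \<Rightarrow> 'b) \<Rightarrow> 'a set \<Rightarrow> 'a rel \<Rightarrow> 'b set \<Rightarrow> 'b rel \<Rightarrow> bool" where
  "part_of e M r H s \<longleftrightarrow>
     preorder_on M r \<and> preorder_on H s \<and>
     inj_on e M \<and> e ` M \<subseteq> H \<and> r = Restr (inv_image s e) M"

definition semilattice_over :: "('a \<Rightarrow> 'b) \<Rightarrow> 'a set \<Rightarrow> 'a rel \<Rightarrow> 'b set \<Rightarrow> 'b rel \<Rightarrow> bool" where
  "semilattice_over e M r H s \<longleftrightarrow> part_of e M r H s \<and> semilattice_on H s"

definition minimal_semilattice_over ::
    "('a \<Rightarrow> 'b) \<Rightarrow> 'a set \<Rightarrow> 'a rel \<Rightarrow> 'b set \<Rightarrow> 'b rel \<Rightarrow> bool" where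
  "minimal_semilattice_over e M r H s \<longleftrightarrow>
     semilattice_over e M r H s \<and>
     \<not> (\<exists>H0. H0 \<subset> H \<and> e ` M \<subseteq> H0 \<and>
           (\<forall>a\<in>H0. \<forall>b\<in>H0. \<forall>c\<in>H. equiv_in s c (meet H s a b) \<longrightarrow> c \<in> H0))"

definition preord_hom :: "'a set \<Rightarrow> 'a rel \<Rightarrow> 'b set \<Rightarrow> 'b rel \<Rightarrow> ('a \<times> 'b) set \<Rightarrow> bool" where
  "preord_hom A r A' r' R \<longleftrightarrow>
     R \<subseteq> A \<times> A' \<and>
     (\<forall>a\<in>A. \<exists>a'\<in>A'. (a, a') \<in> R) \<and>
     (\<forall>a\<in>A. \<forall>a1\<in>A'. \<forall>a2\<in>A'. (a, a1) \<in> R \<and> equiv_in r' a1 a2 \<longrightarrow> (a, a2) \<in> R) \<and>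
     (\<forall>a\<in>A. \<forall>b\<in>A. \<forall>a'\<in>A'. \<forall>b'\<in>A'.
        (a, a') \<in> R \<and> (b, b') \<in> R \<and> (a, b) \<in> r \<longrightarrow> (a', b') \<in> r')"

definition preord_iso :: "'a set \<Rightarrow> 'a rel \<Rightarrow> 'b set \<Rightarrow> 'b rel \<Rightarrow> ('a \<times> 'b) set \<Rightarrow> bool" where
  "preord_iso A r A' r' R \<longleftrightarrow>
     preord_hom A r A' r' R \<and>
     (\<forall>a\<in>A. \<forall>b\<in>A. \<forall>a'\<in>A'. \<forall>b'\<in>A'.
        (a, a') \<in> R \<and> (b, b') \<in> R \<and> (a', b') \<in> r' \<longrightarrow> (a, b) \<in> r)"

definition rel_onto :: "'a set \<Rightarrow> 'b set \<Rightarrow> ('a \<times> 'b) set \<Rightarrow> bool" where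
  "rel_onto A A' R \<longleftrightarrow> (\<forall>a'\<in>A'. \<exists>a\<in>A. (a, a') \<in> R)"

text \<open>\<open>e\<close> and \<open>e'\<close> are the inclusions of \<open>M\<close> in \<open>A\<close> and \<open>A'\<close>, as in \<^const>\<open>part_of\<close>.\<close>

definition isomorphic_over ::
    "('m \<Rightarrow> 'a) \<Rightarrow> ('m \<Rightarrow> 'b) \<Rightarrow> 'm set \<Rightarrow> 'a set \<Rightarrow> 'a rel \<Rightarrow> 'b set \<Rightarrow> 'b rel \<Rightarrow> bool" where
  "isomorphic_over e e' M A r A' r' \<longleftrightarrow>
     (\<exists>R. preord_iso A r A' r' R \<and> rel_onto A A' R \<and> (\<forall>a\<in>M. (e a, e' a) \<in> R))"

definition entails_preorder :: "'a set \<Rightarrow> ('a list \<Rightarrow> 'a \<Rightarrow> bool) \<Rightarrow> 'a rel" where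
  "entails_preorder M ent = {(a, b). a \<in> M \<and> b \<in> M \<and> ent [a] b}"

definition represents_entailment ::
    "('a \<Rightarrow> 'b) \<Rightarrow> 'a set \<Rightarrow> ('a list \<Rightarrow> 'a \<Rightarrow> bool) \<Rightarrow> 'b set \<Rightarrow> 'b rel \<Rightarrow> bool" where
  "represents_entailment e M ent H s \<longleftrightarrow>
     (\<forall>as b. as \<in> lists M \<and> as \<noteq> [] \<and> b \<in> M \<longrightarrow>
        (ent as b \<longleftrightarrow> (meet_list H s (map e as), e b) \<in> s))"

end

theory Submission
  imports Defs
begin

text \<open>
  Weakening, exchange and cut make \<open>ent as b\<close> depend only on the set of members of \<open>as\<close>, so the
  nonempty finite sequences over \<open>M\<close>, ordered by ``\<open>as\<close> entails every member of \<open>bs\<close>'', form a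
  semilattice with concatenation as meet; adjoining \<open>M\<close> itself gives \<open>H\<close>.  Conversely, minimality
  forces every element of a minimal semilattice to be equivalent to a meet of members of \<open>M\<close>, and
  the comparison of two such meets is dictated by the entailment, which yields uniqueness.
\<close>

section \<open>Greatest lower bounds in a preordered semilattice\<close>

lemma meet_is_meet:
  assumes "semilattice_on H s" "a \<in> H" "b \<in> H"
  shows "is_meet H s a b (meet H s a b)"
  using assms unfolding semilattice_on_def meet_def by (metis someI_ex)

lemma le_meet_iff:
  assumes S: "semilattice_on H s" and H: "a \<in> H" "b \<in> H" "x \<in> H"
  shows "(x, meet H s a b) \<in> s \<longleftrightarrow> (x, a) \<in> s \<and> (x, b) \<in> s"
proof -
  have "trans s"
    using S by (simp add: semilattice_on_def preorder_on_def)
  then show ?thesis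
    using meet_is_meet[OF S H(1,2)] H(3) unfolding is_meet_def by (meson transD)
qed

lemma is_meet_equiv_meet:
  assumes S: "semilattice_on H s" and H: "a \<in> H" "b \<in> H" and c: "is_meet H s a b c"
  shows "equiv_in s c (meet H s a b)"
  using meet_is_meet[OF S H] c unfolding is_meet_def equiv_in_def by blast

lemma foldl_meet:
  assumes S: "semilattice_on H s"
  shows "x \<in> H \<Longrightarrow> set as \<subseteq> H \<Longrightarrow> foldl (meet H s) x as \<in> H \<and>
    (\<forall>y\<in>H. (y, foldl (meet H s) x as) \<in> s \<longleftrightarrow> (\<forall>a\<in>insert x (set as). (y, a) \<in> s))"
proof (induction as arbitrary: x)
  case (Cons a as)
  then have a: "a \<in> H" "set as \<subseteq> H" by auto
  have "meet H s x a \<in> H"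
    using meet_is_meet[OF S] Cons.prems a by (auto simp: is_meet_def)
  from Cons.IH[OF this a(2)] show ?case
    using le_meet_iff[OF S Cons.prems(1) a(1)] by auto
qed auto

lemma meet_list_closed:
  assumes "semilattice_on H s" "as \<noteq> []" "set as \<subseteq> H"
  shows "meet_list H s as \<in> H"
  using assms foldl_meet[of H s "hd as" "tl as"]
  by (cases as) (auto simp: meet_list_def)

lemma le_meet_list_iff:
  assumes "semilattice_on H s" "as \<noteq> []" "set as \<subseteq> H" "y \<in> H"
  shows "(y, meet_list H s as) \<in> s \<longleftrightarrow> (\<forall>a\<in>set as. (y, a) \<in> s)"
  using assms foldl_meet[of H s "hd as" "tl as"]
  by (cases as) (auto simp: meet_list_def)

section \<open>Minimal semilattices: generation and uniqueness\<close>

text \<open>The universal property of the right-hand meet reduces the comparison to single elements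
  of \<open>M\<close>, where \<open>rep\<close> applies. Since the right-hand side mentions neither
  \<open>H\<close> nor \<open>s\<close>, any two representing semilattices order such meets
  alike.\<close>

lemma represented_meet_list_le_iff:
  assumes S: "semilattice_on H s" and e: "e ` M \<subseteq> H"
    and rep: "represents_entailment e M ent H s"
    and as: "as \<in> lists M" "as \<noteq> []" and bs: "bs \<in> lists M" "bs \<noteq> []"
  shows "(meet_list H s (map e as), meet_list H s (map e bs)) \<in> s \<longleftrightarrow> (\<forall>b\<in>set bs. ent as b)"
proof -
  have sub: "set (map e as) \<subseteq> H" "set (map e bs) \<subseteq> H"
    using e as bs by auto
  have "meet_list H s (map e as) \<in> H"
    using meet_list_closed[OF S _ sub(1)] as by simp
  then have "(meet_list H s (map e as), meet_list H s (map e bs)) \<in> s \<longleftrightarrow>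
      (\<forall>b\<in>set bs. (meet_list H s (map e as), e b) \<in> s)"
    using le_meet_list_iff[OF S _ sub(2)] bs by simp
  also have "\<dots> \<longleftrightarrow> (\<forall>b\<in>set bs. ent as b)"
    using rep as bs by (auto simp: represents_entailment_def in_lists_conv_set)
  finally show ?thesis .
qed

text \<open>The elements equivalent to a finite meet from \<open>M\<close> contain the image of
  \<open>M\<close> and are closed under meets, so minimality leaves no others.\<close>

lemma minimal_semilattice_generated:
  assumes min: "minimal_semilattice_over e M r H s" and h: "h \<in> H"
  shows "\<exists>as. as \<in> lists M \<and> as \<noteq> [] \<and> equiv_in s h (meet_list H s (map e as))"
proof -
  define H0 where
    "H0 = {h \<in> H. \<exists>as. as \<in> lists M \<and> as \<noteq> [] \<and> equiv_in s h (meet_list H s (map e as))}"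
  have S: "semilattice_on H s" and e: "e ` M \<subseteq> H"
    using min by (auto simp: minimal_semilattice_over_def semilattice_over_def part_of_def)
  then have s: "refl_on H s" "trans s"
    by (auto simp: semilattice_on_def preorder_on_def)
  have sub0: "e ` M \<subseteq> H0"
  proof
    fix x assume "x \<in> e ` M"
    then obtain a where a: "a \<in> M" "x = e a" by blast
    then have "equiv_in s x (meet_list H s (map e [a]))"
      using e s(1) by (auto simp: meet_list_def equiv_in_def refl_on_def)
    then show "x \<in> H0"
      using a e unfolding H0_def by (auto intro!: exI[of _ "[a]"])
  qed
  have closed0: "c \<in> H0"
    if ab0: "a \<in> H0" "b \<in> H0" and c: "c \<in> H" "equiv_in s c (meet H s a b)" for a b c
  proof -
    obtain as bs where as: "as \<in> lists M" "as \<noteq> []" "equiv_in s a (meet_list H s (map e as))"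
      and bs: "bs \<in> lists M" "bs \<noteq> []" "equiv_in s b (meet_list H s (map e bs))"
      and ab: "a \<in> H" "b \<in> H"
      using ab0 unfolding H0_def by blast
    let ?m = "\<lambda>xs. meet_list H s (map e xs)"
    have sub: "set (map e as) \<subseteq> H" "set (map e bs) \<subseteq> H" "set (map e (as @ bs)) \<subseteq> H"
      using e as bs by auto
    have m: "?m as \<in> H" "?m bs \<in> H" "?m (as @ bs) \<in> H"
      using meet_list_closed[OF S] sub as bs by simp_all
    \<comment> \<open>Both elements have the same lower bounds, and that makes them equivalent:
      concatenating the lists represents the meet.\<close>
    have le: "(y, ?m (as @ bs)) \<in> s \<longleftrightarrow> (y, meet H s a b) \<in> s" if y: "y \<in> H" for y
    proof -
      have "(y, ?m (as @ bs)) \<in> s \<longleftrightarrow> (y, ?m as) \<in> s \<and> (y, ?m bs) \<in> s"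
        using le_meet_list_iff[OF S _ sub(3) y] le_meet_list_iff[OF S _ sub(1) y]
          le_meet_list_iff[OF S _ sub(2) y] as bs by auto
      also have "\<dots> \<longleftrightarrow> (y, a) \<in> s \<and> (y, b) \<in> s"
        using as(3) bs(3) s(2) unfolding equiv_in_def by (meson transD)
      also have "\<dots> \<longleftrightarrow> (y, meet H s a b) \<in> s"
        using le_meet_iff[OF S ab y] by simp
      finally show ?thesis .
    qed
    have "(c, ?m (as @ bs)) \<in> s"
      using le[OF c(1)] c(2) by (simp add: equiv_in_def)
    moreover have "(?m (as @ bs), meet H s a b) \<in> s"
      using le[OF m(3)] s(1) m(3) by (auto simp: refl_on_def)
    then have "(?m (as @ bs), c) \<in> s"
      using c(2) s(2) unfolding equiv_in_def by (meson transD)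
    ultimately have "equiv_in s c (?m (as @ bs))"
      by (simp add: equiv_in_def)
    then show "c \<in> H0"
      using c(1) as bs unfolding H0_def by (auto intro!: exI[of _ "as @ bs"])
  qed
  have "\<not> H0 \<subset> H"
  proof
    assume "H0 \<subset> H"
    then have "\<exists>H0. H0 \<subset> H \<and> e ` M \<subseteq> H0 \<and>
        (\<forall>a\<in>H0. \<forall>b\<in>H0. \<forall>c\<in>H. equiv_in s c (meet H s a b) \<longrightarrow> c \<in> H0)"
      by (intro exI[of _ H0] conjI ballI impI sub0) (assumption, rule closed0)
    then show False
      using min by (simp add: minimal_semilattice_over_def)
  qed
  then have "H0 = H"
    by (auto simp: H0_def)
  then show ?thesis
    using h by (auto simp: H0_def)
qed

text \<open>Two elements correspond when one list over \<open>M\<close> represents both. Generation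
  on each side makes this relation total and onto.\<close>

lemma minimal_representing_semilattices_isomorphic:
  assumes min1: "minimal_semilattice_over e1 M r1 H1 s1" and rep1: "represents_entailment e1 M ent H1 s1"
    and min2: "minimal_semilattice_over e2 M r2 H2 s2" and rep2: "represents_entailment e2 M ent H2 s2"
  shows "isomorphic_over e1 e2 M H1 s1 H2 s2"
proof -
  let ?m1 = "\<lambda>as. meet_list H1 s1 (map e1 as)" and ?m2 = "\<lambda>as. meet_list H2 s2 (map e2 as)"
  define R where "R = {(h, k). h \<in> H1 \<and> k \<in> H2 \<and>
    (\<exists>as. as \<in> lists M \<and> as \<noteq> [] \<and> equiv_in s1 h (?m1 as) \<and> equiv_in s2 k (?m2 as))}"
  have S1: "semilattice_on H1 s1" and e1: "e1 ` M \<subseteq> H1"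
    and S2: "semilattice_on H2 s2" and e2: "e2 ` M \<subseteq> H2"
    using min1 min2 by (auto simp: minimal_semilattice_over_def semilattice_over_def part_of_def)
  then have s1: "refl_on H1 s1" "trans s1" and s2: "refl_on H2 s2" "trans s2"
    by (auto simp: semilattice_on_def preorder_on_def)
  have m1: "?m1 as \<in> H1" if "as \<in> lists M" "as \<noteq> []" for as
    using that e1 by (intro meet_list_closed[OF S1]) auto
  have m2: "?m2 as \<in> H2" if "as \<in> lists M" "as \<noteq> []" for as
    using that e2 by (intro meet_list_closed[OF S2]) auto
  \<comment> \<open>The left-to-right half is monotonicity of the homomorphism, the converse half is
    the extra condition of an isomorphism.\<close>
  have R_le: "(h, h') \<in> s1 \<longleftrightarrow> (k, k') \<in> s2" if hk: "(h, k) \<in> R" "(h', k') \<in> R" for h h' k k'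
  proof -
    obtain as bs where as: "as \<in> lists M" "as \<noteq> []" "equiv_in s1 h (?m1 as)" "equiv_in s2 k (?m2 as)"
      and bs: "bs \<in> lists M" "bs \<noteq> []" "equiv_in s1 h' (?m1 bs)" "equiv_in s2 k' (?m2 bs)"
      using hk unfolding R_def by blast
    have "(h, h') \<in> s1 \<longleftrightarrow> (?m1 as, ?m1 bs) \<in> s1"
      using as(3) bs(3) s1(2) unfolding equiv_in_def by (meson transD)
    also have "\<dots> \<longleftrightarrow> (?m2 as, ?m2 bs) \<in> s2"
      using represented_meet_list_le_iff[OF S1 e1 rep1 as(1,2) bs(1,2)]
        represented_meet_list_le_iff[OF S2 e2 rep2 as(1,2) bs(1,2)] by simp
    also have "\<dots> \<longleftrightarrow> (k, k') \<in> s2"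
      using as(4) bs(4) s2(2) unfolding equiv_in_def by (meson transD)
    finally show ?thesis .
  qed
  have total: "\<exists>k\<in>H2. (h, k) \<in> R" if h: "h \<in> H1" for h
  proof -
    obtain as where as: "as \<in> lists M" "as \<noteq> []" "equiv_in s1 h (?m1 as)"
      using minimal_semilattice_generated[OF min1 h] by blast
    then have "(h, ?m2 as) \<in> R"
      using h m2 s2(1) unfolding R_def equiv_in_def refl_on_def by blast
    then show ?thesis
      using m2[OF as(1,2)] by blast
  qed
  have onto: "\<exists>h\<in>H1. (h, k) \<in> R" if k: "k \<in> H2" for k
  proof -
    obtain as where as: "as \<in> lists M" "as \<noteq> []" "equiv_in s2 k (?m2 as)"
      using minimal_semilattice_generated[OF min2 k] by blast
    then have "(?m1 as, k) \<in> R"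
      using k m1 s1(1) unfolding R_def equiv_in_def refl_on_def by blast
    then show ?thesis
      using m1[OF as(1,2)] by blast
  qed
  have saturated: "(h, k') \<in> R" if k: "(h, k) \<in> R" "k' \<in> H2" "equiv_in s2 k k'" for h k k'
  proof -
    obtain as where "h \<in> H1" "as \<in> lists M" "as \<noteq> []" "equiv_in s1 h (?m1 as)"
      and m: "equiv_in s2 k (?m2 as)"
      using k(1) unfolding R_def by blast
    moreover have "equiv_in s2 k' (?m2 as)"
      using m k(3) s2(2) unfolding equiv_in_def by (meson transD)
    ultimately show ?thesis
      using k(2) unfolding R_def by blast
  qed
  have "R \<subseteq> H1 \<times> H2"
    by (auto simp: R_def)
  then have "preord_iso H1 s1 H2 s2 R"
    unfolding preord_iso_def preord_hom_def using R_le total saturated by (intro conjI) blast+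
  moreover have "(e1 a, e2 a) \<in> R" if a: "a \<in> M" for a
    using a e1 e2 s1(1) s2(1) unfolding R_def
    by (auto intro!: exI[of _ "[a]"] simp: meet_list_def equiv_in_def refl_on_def)
  ultimately show ?thesis
    using onto unfolding isomorphic_over_def rel_onto_def by blast
qed

section \<open>Structural consequences of the entailment rules\<close>

locale entailment =
  fixes M :: "'a set" and ent :: "'a list \<Rightarrow> 'a \<Rightarrow> bool"
  assumes ent_refl: "a \<in> M \<Longrightarrow> ent [a] a"
    and ent_weaken: "as \<in> lists M \<Longrightarrow> as \<noteq> [] \<Longrightarrow> b \<in> M \<Longrightarrow> c \<in> M \<Longrightarrow>
           ent as b \<Longrightarrow> ent (as @ [c]) b"
    and ent_exchange: "as \<in> lists M \<Longrightarrow> bs \<in> lists M \<Longrightarrow> x \<in> M \<Longrightarrow> y \<in> M \<Longrightarrow> b \<in> M \<Longrightarrow>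
           ent (as @ [x, y] @ bs) b \<Longrightarrow> ent (as @ [y, x] @ bs) b"
    and ent_cut: "as \<in> lists M \<Longrightarrow> as \<noteq> [] \<Longrightarrow> b \<in> M \<Longrightarrow> c \<in> M \<Longrightarrow>
           ent as c \<Longrightarrow> ent (as @ [c]) b \<Longrightarrow> ent as b"
begin

lemma ent_append:
  assumes "as \<in> lists M" "as \<noteq> []" "b \<in> M" "ent as b" "bs \<in> lists M"
  shows "ent (as @ bs) b"
  using assms(5)
proof (induction bs rule: rev_induct)
  case (snoc c bs)
  then show ?case
    using ent_weaken[of "as @ bs" b c] assms by simp
qed (simp add: assms)

lemma ent_move_right:
  assumes "qs \<in> lists M" "ps \<in> lists M" "rs \<in> lists M" "x \<in> M" "b \<in> M" "ent (ps @ x # qs @ rs) b"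
  shows "ent (ps @ qs @ x # rs) b"
  using assms
proof (induction qs arbitrary: ps)
  case (Cons q qs)
  then have "ent (ps @ [q, x] @ qs @ rs) b"
    using ent_exchange[of ps "qs @ rs" x q b] by simp
  then show ?case
    using Cons.IH[of "ps @ [q]"] Cons.hyps Cons.prems by simp
qed simp

text \<open>Sending the head of \<open>as\<close> to the far end, once per element, rotates the
  whole list. Rotations are all the reordering that the later arguments require.\<close>

lemma ent_append_commute:
  assumes "as \<in> lists M" "bs \<in> lists M" "b \<in> M" "ent (as @ bs) b"
  shows "ent (bs @ as) b"
  using assms
proof (induction as arbitrary: bs)
  case (Cons a as)
  then have "ent (as @ bs @ [a]) b"
    using ent_move_right[of "as @ bs" "[]" "[]" a b] by simp
  then show ?case
    using Cons.IH[of "bs @ [a]"] Cons.hyps Cons.prems by simp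
qed simp

text \<open>Start from \<open>ent [c] c\<close>, weaken by the remaining elements, and rotate
  \<open>c\<close> back to its position.\<close>

lemma ent_member:
  assumes "as \<in> lists M" "c \<in> set as"
  shows "ent as c"
proof -
  obtain xs ys where as: "as = xs @ c # ys"
    using assms(2) by (meson split_list)
  then have M: "c \<in> M" "xs \<in> lists M" "ys \<in> lists M"
    using assms(1) by auto
  then have "ent ([c] @ ys @ xs) c"
    using ent_append[of "[c]" c "ys @ xs"] ent_refl by simp
  then show ?thesis
    using ent_append_commute[of "[c] @ ys" xs c] M as by simp
qed

text \<open>Cut removes the last premise only, so the induction peels \<open>cs\<close> from the
  right; weakening supplies the entailment of \<open>c\<close> from \<open>as @ cs\<close>.\<close>

lemma ent_cut_list:
  assumes "cs \<in> lists M" "as \<in> lists M" "as \<noteq> []" "b \<in> M" "\<forall>c\<in>set cs. ent as c" "ent (as @ cs) b"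
  shows "ent as b"
  using assms
proof (induction cs rule: rev_induct)
  case (snoc c cs)
  then have "ent (as @ cs) c"
    using ent_append[of as c cs] by simp
  then have "ent (as @ cs) b"
    using ent_cut[of "as @ cs" b c] snoc.prems by simp
  then show ?case
    using snoc by simp
qed simp

text \<open>Weaken \<open>ent cs b\<close> by \<open>as\<close>, rotate \<open>as\<close> to the
  front, then cut away all of \<open>cs\<close>. This is what makes \<open>order\<close>
  transitive.\<close>

lemma ent_trans:
  assumes "as \<in> lists M" "as \<noteq> []" "cs \<in> lists M" "cs \<noteq> []" "b \<in> M"
    and "\<forall>c\<in>set cs. ent as c" "ent cs b"
  shows "ent as b"
  using assms ent_append[of cs b as] ent_append_commute[of cs as b] ent_cut_list[of cs as b] by simp

section \<open>The semilattice of finite sequences\<close>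

text \<open>\<open>Inl\<close> carries the copy of \<open>M\<close> and \<open>Inr\<close> the
  formal meets; reading both as lists lets one formula define the order.\<close>

fun members :: "'a + 'a list \<Rightarrow> 'a list" where
  "members (Inl a) = [a]"
| "members (Inr as) = as"

definition carrier :: "('a + 'a list) set" where
  "carrier = {x. members x \<in> lists M \<and> members x \<noteq> []}"

text \<open>No quotient is taken: lists with the same members stay distinct but equivalent, as do
  \<open>Inl a\<close> and \<open>Inr [a]\<close>.\<close>

definition order :: "('a + 'a list) rel" where
  "order = {(x, y). x \<in> carrier \<and> y \<in> carrier \<and> (\<forall>b\<in>set (members y). ent (members x) b)}"

lemma preorder_on_carrier: "preorder_on carrier order"
proof -
  have "trans order"
  proof (rule transI)
    fix x y z assume *: "(x, y) \<in> order" "(y, z) \<in> order"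
    then have "ent (members x) b" if "b \<in> set (members z)" for b
      using ent_trans[of "members x" "members y" b] that
      unfolding order_def carrier_def by (auto simp: in_lists_conv_set)
    with * show "(x, z) \<in> order"
      by (simp add: order_def)
  qed
  then show ?thesis
    unfolding preorder_on_def refl_on_def
    by (auto simp: order_def carrier_def intro!: ent_member)
qed

text \<open>Being below an element depends only on the set of its members, and
  \<open>ent_member\<close> puts \<open>z\<close> below \<open>x\<close> and \<open>y\<close>.
  Allowing any \<open>z\<close> with the right members covers \<open>Inr [a]\<close> and
  \<open>Inr (a # as)\<close> besides concatenations.\<close>

lemma is_meet_append:
  assumes "x \<in> carrier" "y \<in> carrier" "z \<in> carrier" "set (members z) = set (members x) \<union> set (members y)"
  shows "is_meet carrier order x y z"
  using assms by (auto simp: is_meet_def order_def carrier_def intro: ent_member)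

lemma semilattice_on_carrier: "semilattice_on carrier order"
  unfolding semilattice_on_def
proof (intro conjI ballI preorder_on_carrier)
  fix x y assume "x \<in> carrier" "y \<in> carrier"
  then show "\<exists>z. is_meet carrier order x y z"
    by (intro exI[of _ "Inr (members x @ members y)"] is_meet_append) (auto simp: carrier_def)
qed

lemma semilattice_over_carrier: "semilattice_over Inl M (entails_preorder M ent) carrier order"
proof -
  have r: "entails_preorder M ent = Restr (inv_image order Inl) M"
    by (auto simp: entails_preorder_def order_def carrier_def)
  have "trans (inv_image order Inl)"
    using preorder_on_carrier by (auto simp: preorder_on_def intro: trans_inv_image)
  then have "trans (entails_preorder M ent)"
    unfolding r by (rule trans_Restr)
  moreover have "refl_on M (entails_preorder M ent)" "entails_preorder M ent \<subseteq> M \<times> M"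
    by (auto simp: entails_preorder_def refl_on_def ent_refl)
  ultimately have "preorder_on M (entails_preorder M ent)"
    by (simp add: preorder_on_def)
  moreover have "Inl ` M \<subseteq> carrier"
    by (auto simp: carrier_def)
  ultimately show ?thesis
    unfolding semilattice_over_def part_of_def
    by (intro conjI r preorder_on_carrier semilattice_on_carrier) simp_all
qed

text \<open>Every \<open>Inr\<close> list is built from the copy of \<open>M\<close> by repeated
  meets, one element at a time.\<close>

lemma carrier_generated:
  assumes M: "Inl ` M \<subseteq> H0"
    and closed: "\<And>a b c. a \<in> H0 \<Longrightarrow> b \<in> H0 \<Longrightarrow> c \<in> carrier \<Longrightarrow>
      equiv_in order c (meet carrier order a b) \<Longrightarrow> c \<in> H0"
  shows "carrier \<subseteq> H0"
proof
  \<comment> \<open>The closure hypothesis speaks of the meet chosen by \<open>meet\<close>; every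
    other greatest lower bound is equivalent to it and hence is captured too.\<close>
  have step: "z \<in> H0"
    if "x \<in> H0" "y \<in> H0" "x \<in> carrier" "y \<in> carrier" "z \<in> carrier"
      "set (members z) = set (members x) \<union> set (members y)" for x y z
    using closed[of x y z] is_meet_equiv_meet[OF semilattice_on_carrier] is_meet_append that by blast
  have Inl: "Inl a \<in> H0" "Inl a \<in> carrier" if "a \<in> M" for a
    using M that by (auto simp: carrier_def)
  have Inr: "Inr as \<in> H0" if "as \<noteq> []" "as \<in> lists M" for as
    using that
  proof (induction as rule: list_nonempty_induct)
    case (single a)
    \<comment> \<open>\<open>Inr [a]\<close> lies outside the copy of \<open>M\<close>, but it is a
      meet of \<open>Inl a\<close> with itself.\<close>
    then show ?case
      using step[of "Inl a" "Inl a" "Inr [a]"] Inl[of a] by (simp add: carrier_def)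
  next
    case (cons a as)
    then show ?case
      using step[of "Inl a" "Inr as" "Inr (a # as)"] Inl[of a] by (simp add: carrier_def)
  qed
  fix x assume "x \<in> carrier"
  then show "x \<in> H0"
    using Inl(1) Inr by (cases x) (auto simp: carrier_def)
qed

lemma minimal_semilattice_over_carrier:
  "minimal_semilattice_over Inl M (entails_preorder M ent) carrier order"
  unfolding minimal_semilattice_over_def
proof (intro conjI notI semilattice_over_carrier, elim exE conjE)
  fix H0
  assume H0: "H0 \<subset> carrier" "Inl ` M \<subseteq> H0"
    and closed: "\<forall>a\<in>H0. \<forall>b\<in>H0. \<forall>c\<in>carrier. equiv_in order c (meet carrier order a b) \<longrightarrow> c \<in> H0"
  have "carrier \<subseteq> H0"
    by (rule carrier_generated[OF H0(2)]) (rule closed[rule_format])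
  with H0(1) show False
    by simp
qed

lemma represents_entailment_carrier: "represents_entailment Inl M ent carrier order"
  unfolding represents_entailment_def
proof (intro allI impI, elim conjE)
  fix as b assume as: "as \<in> lists M" "as \<noteq> []" and b: "b \<in> M"
  let ?m = "meet_list carrier order (map Inl as)"
  have sub: "set (map Inl as) \<subseteq> carrier"
    using as by (auto simp: carrier_def)
  have m: "?m \<in> carrier"
    using meet_list_closed[OF semilattice_on_carrier _ sub] as by simp
  have Inr: "Inr as \<in> carrier"
    using as by (simp add: carrier_def)
  have trans: "trans order" and refl: "(?m, ?m) \<in> order"
    using preorder_on_carrier m by (auto simp: preorder_on_def refl_on_def)
  \<comment> \<open>Lying below \<open>Inr as\<close> means lying below each \<open>Inl a\<close>
    with \<open>a\<close> in \<open>as\<close>, so the formal meet has the same lower bounds as the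
    chosen one and can replace it.\<close>
  have le: "(y, ?m) \<in> order \<longleftrightarrow> (y, Inr as) \<in> order" if "y \<in> carrier" for y
    using le_meet_list_iff[OF semilattice_on_carrier _ sub that] as sub Inr that
    by (auto simp: order_def)
  have "(Inr as, ?m) \<in> order" "(?m, Inr as) \<in> order"
    using le[OF m] le[OF Inr] refl Inr preorder_on_carrier
    by (auto simp: preorder_on_def refl_on_def)
  then have "(?m, Inl b) \<in> order \<longleftrightarrow> (Inr as, Inl b) \<in> order"
    using trans by (meson transD)
  also have "\<dots> \<longleftrightarrow> ent as b"
    using Inr b by (auto simp: order_def carrier_def)
  finally show "ent as b \<longleftrightarrow> (?m, Inl b) \<in> order"
    by simp
qed

end

theorem theorem3:
  fixes M :: "'a set" and ent :: "'a list \<Rightarrow> 'a \<Rightarrow> bool"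
  assumes "\<And>a. a \<in> M \<Longrightarrow> ent [a] a"
    and "\<And>as b c. as \<in> lists M \<Longrightarrow> as \<noteq> [] \<Longrightarrow> b \<in> M \<Longrightarrow> c \<in> M \<Longrightarrow>
           ent as b \<Longrightarrow> ent (as @ [c]) b"
    and "\<And>as bs x y b. as \<in> lists M \<Longrightarrow> bs \<in> lists M \<Longrightarrow> x \<in> M \<Longrightarrow> y \<in> M \<Longrightarrow> b \<in> M \<Longrightarrow>
           ent (as @ [x, y] @ bs) b \<Longrightarrow> ent (as @ [y, x] @ bs) b"
    and "\<And>as b c. as \<in> lists M \<Longrightarrow> as \<noteq> [] \<Longrightarrow> b \<in> M \<Longrightarrow> c \<in> M \<Longrightarrow>
           ent as c \<Longrightarrow> ent (as @ [c]) b \<Longrightarrow> ent as b"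
  shows "(\<exists>(H :: ('a + 'a list) set) s.
            minimal_semilattice_over Inl M (entails_preorder M ent) H s \<and>
            represents_entailment Inl M ent H s) \<and>
         (\<forall>(e1 :: 'a \<Rightarrow> 'b) H1 s1 (e2 :: 'a \<Rightarrow> 'c) H2 s2.
            minimal_semilattice_over e1 M (entails_preorder M ent) H1 s1 \<and>
            represents_entailment e1 M ent H1 s1 \<and>
            minimal_semilattice_over e2 M (entails_preorder M ent) H2 s2 \<and>
            represents_entailment e2 M ent H2 s2 \<longrightarrow>
            isomorphic_over e1 e2 M H1 s1 H2 s2)"
proof -
  interpret entailment M ent
    by unfold_locales (fact assms)+
  show ?thesis
    using minimal_semilattice_over_carrier represents_entailment_carrier
      minimal_representing_semilattices_isomorphic by blast
qed

end
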